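(* Let $k\ge 1$ and $r\geq 1$ be integers. For every integer $n\ge 0$, the $r$-times iterated binomial transform $\{b_{k,n}^{(r)}\}_{n\ge 0}$ of the $k$-Lucas sequence is given by the Binet formula $$b_{k,n}^{(r)}=\left(\frac{k+\sqrt{k^{2}+4}}{2}+r\right)^{n}+\left(\frac{k-\sqrt{k^{2}+4}}{2}+r\right)^{n}.$$
   Context: The $k$-Lucas sequence $\{L_{k,n}\}_{n\ge 0}$ is defined by $L_{k,0}=2$, $L_{k,1}=k$ and $L_{k,n+1}=kL_{k,n}+L_{k,n-1}$ for $n\ge 1$. The binomial transform of a sequence $\{x_0,x_1,x_2,\ldots\}$ is the sequence $\{b_n\}$ with $b_n=\sum_{i=0}^{n}\binom{n}{i}x_i$. The sequence $\{b_{k,n}^{(r)}\}_{n\ge 0}$ is obtained by applying the binomial transform $r$ times to the $k$-Lucas sequence, i.e. $b_{k,n}^{(0)}=L_{k,n}$ and $b_{k,n}^{(r)}=\sum_{i=0}^{n}\binom{n}{i}b_{k,i}^{(r-1)}$ for $r\ge 1$. *)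

theory Defs
  imports Complex_Main
begin

fun lucas :: "nat \<Rightarrow> nat \<Rightarrow> nat" where
  "lucas k 0 = 2"
| "lucas k (Suc 0) = k"
| "lucas k (Suc (Suc n)) = k * lucas k (Suc n) + lucas k n"

definition binomial_transform :: "(nat \<Rightarrow> 'a::comm_semiring_1) \<Rightarrow> nat \<Rightarrow> 'a" where
  "binomial_transform x n = (\<Sum>i=0..n. of_nat (n choose i) * x i)"

definition iterated_lucas :: "nat \<Rightarrow> nat \<Rightarrow> nat \<Rightarrow> nat" where
  "iterated_lucas k r = (binomial_transform ^^ r) (lucas k)"

end

theory Submission
  imports Defs
begin

text \<open>
  By the binomial theorem, the binomial transform sends the geometric sequence with ratio
  \<open>a\<close> to the one with ratio \<open>a + 1\<close>. It is also linear. The \<open>k\<close>-Lucas sequence is a sum of two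
  geometric sequences, whose ratios are the roots of \<open>x\<^sup>2 = k x + 1\<close>, so each transform keeps
  it a sum of two geometric sequences and shifts both ratios by one; after \<open>r\<close> transforms both
  are shifted by \<open>r\<close>.
\<close>

lemma binomial_transform_add:
  "binomial_transform (\<lambda>i. x i + y i) n = binomial_transform x n + binomial_transform y n"
  by (simp add: binomial_transform_def distrib_left sum.distrib)

lemma binomial_transform_power:
  "binomial_transform (\<lambda>i. a ^ i) n = (a + 1) ^ n"
  by (simp add: binomial_transform_def binomial_ring atMost_atLeast0)

lemma of_nat_binomial_transform:
  "of_nat (binomial_transform x n) = binomial_transform (\<lambda>i. of_nat (x i)) n"
  by (simp add: binomial_transform_def)

text \<open>
  The hypotheses give \<open>(x - a) (x - b) = x\<^sup>2 - k x - 1\<close>, the characteristic polynomial of the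
  Lucas recurrence, so the power sums of \<open>a\<close> and \<open>b\<close> satisfy that recurrence; the initial
  values \<open>2\<close> and \<open>k\<close> are the power sums of exponents \<open>0\<close> and \<open>1\<close>.
\<close>

lemma lucas_eq_power_sum:
  fixes a b :: "'a::comm_ring_1"
  assumes "a + b = of_nat k" and "a * b = -1"
  shows "of_nat (lucas k n) = a ^ n + b ^ n"
using assms
proof (induction k n rule: lucas.induct)
  case (3 k n)
  have "a ^ Suc (Suc n) + b ^ Suc (Suc n)
      = (a + b) * (a ^ Suc n + b ^ Suc n) - (a * b) * (a ^ n + b ^ n)"
    by (simp add: algebra_simps)
  also have "\<dots> = of_nat k * of_nat (lucas k (Suc n)) + of_nat (lucas k n)"
    using 3 by simp
  finally show ?case by simp
qed simp_all

lemma iterated_lucas_eq_power_sum: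
  fixes a b :: "'a::comm_ring_1"
  assumes "a + b = of_nat k" and "a * b = -1"
  shows "of_nat (iterated_lucas k r n) = (a + of_nat r) ^ n + (b + of_nat r) ^ n"
proof (induction r arbitrary: n)
  case 0
  show ?case
    using lucas_eq_power_sum[OF assms] by (simp add: iterated_lucas_def)
next
  case (Suc r)
  have "of_nat (iterated_lucas k (Suc r) n)
      = binomial_transform (\<lambda>i. of_nat (iterated_lucas k r i) :: 'a) n"
    by (simp add: iterated_lucas_def of_nat_binomial_transform)
  also have "\<dots> = (a + of_nat r + 1) ^ n + (b + of_nat r + 1) ^ n"
    by (simp only: Suc.IH binomial_transform_add binomial_transform_power)
  finally show ?case by (simp add: add_ac)
qed

theorem mainTheorem2:
  fixes k r n :: nat
  assumes "k \<ge> 1" and "r \<ge> 1"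
  shows "real (iterated_lucas k r n) =
    ((real k + sqrt ((real k)\<^sup>2 + 4)) / 2 + real r) ^ n +
    ((real k - sqrt ((real k)\<^sup>2 + 4)) / 2 + real r) ^ n"
proof (rule iterated_lucas_eq_power_sum)
  let ?s = "sqrt ((real k)\<^sup>2 + 4)"
  show "(real k + ?s) / 2 + (real k - ?s) / 2 = real k"
    by (simp add: field_simps)
  have "(real k + ?s) / 2 * ((real k - ?s) / 2) = ((real k)\<^sup>2 - ?s\<^sup>2) / 4"
    by (simp add: field_simps power2_eq_square)
  also have "\<dots> = -1"
    by simp
  finally show "(real k + ?s) / 2 * ((real k - ?s) / 2) = -1" .
qed

end
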